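(* Let $\mathfrak{m}$ be a convex polygon in $\mathbb{R}^2$ with vertex set $\{\mathbf{v}_i\}$. Given any set of generalized barycentric coordinates $\{\lambda_i\}$ associated to $\mathfrak{m}$, $$\sum_{i,j}\operatorname{rot}(\lambda_i\nabla\lambda_j)\,\bigl(\operatorname{rot}(\mathbf{v}_j-\mathbf{v}_i)\bigr)^T=\mathbb{I},$$ where $\mathbb{I}$ is the $2\times2$ identity matrix. Further, for any real $2\times 2$ matrix $\mathbb{A}$, $$\sum_{i,j}\bigl((-\operatorname{rot}\mathbb{A}\mathbf{v}_i)\cdot\mathbf{v}_j\bigr)\operatorname{rot}(\lambda_i\nabla\lambda_j)=\mathbb{A}\mathbf{x}.$$ Thus, $\operatorname{span}\{\operatorname{rot}(\lambda_i\nabla\lambda_j) : \mathbf{v}_i,\mathbf{v}_j\in\mathfrak{m}\}\supseteq\mathcal{P}_1\Lambda^1(\mathfrak{m})$.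
   Context: Generalized barycentric coordinates on $\mathfrak{m}$: non-negative functions $\lambda_i:\mathfrak{m}\to\mathbb{R}$, one for each vertex $\mathbf{v}_i$, such that every linear function $L$ (polynomial of degree at most 1) satisfies $L=\sum_i L(\mathbf{v}_i)\lambda_i$ on $\mathfrak{m}$. All sums run over all vertex indices of $\mathfrak{m}$ independently. Vectors (vertices, gradients, and the position $\mathbf{x}=(x_1,x_2)^T$) are column vectors; $\mathbf{v}_i\in\mathfrak{m}$ in the span refers to vertices of $\mathfrak{m}$. The operator $\operatorname{rot}$ is left multiplication by the matrix $\begin{bmatrix}0&-1\\1&0\end{bmatrix}$. The $\lambda_i$ are assumed differentiable wherever gradients are written: the identities and the span inclusion are understood as statements about functions of $\mathbf{x}$ on the set of points of $\mathfrak{m}$ at which all $\lambda_i$ are differentiable relative to $\mathfrak{m}$ (i.e. $\lambda_i(\mathbf{y})=\lambda_i(\mathbf{x})+\nabla\lambda_i(\mathbf{x})\cdot(\mathbf{y}-\mathbf{x})+o(|\mathbf{y}-\mathbf{x}|)$ for $\mathbf{y}\in\mathfrak{m}$). $\mathcal{P}_1\Lambda^1(\mathfrak{m})$ is the space of differential 1-forms on $\mathfrak{m}$ with polynomial coefficients of degree at most 1, identified via vector proxies $u_1dx_1+u_2dx_2\leftrightarrow(u_1,u_2)^T$ with the vector fields all of whose components are polynomials of degree at most 1. Span means finite real linear combinations. *)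

theory Defs
  imports "HOL-Analysis.Analysis"
begin

definition convex_polygon :: "(real^2) set \<Rightarrow> bool" where
  "convex_polygon m \<longleftrightarrow> polytope m \<and> interior m \<noteq> {}"

definition vertices_of :: "(real^2) set \<Rightarrow> (real^2) set" where
  "vertices_of m = {x. x extreme_point_of m}"

definition poly_deg_le_1 :: "(real^2 \<Rightarrow> real) \<Rightarrow> bool" where
  "poly_deg_le_1 p \<longleftrightarrow> (\<exists>a b c. \<forall>x. p x = a + b * x$1 + c * x$2)"

definition gen_bary_coords ::
    "(real^2) set \<Rightarrow> 'i set \<Rightarrow> ('i \<Rightarrow> real^2) \<Rightarrow> ('i \<Rightarrow> real^2 \<Rightarrow> real) \<Rightarrow> bool" where
  "gen_bary_coords m I v lam \<longleftrightarrow>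
     (\<forall>i\<in>I. \<forall>x\<in>m. 0 \<le> lam i x) \<and>
     (\<forall>L. poly_deg_le_1 L \<longrightarrow> (\<forall>x\<in>m. L x = (\<Sum>i\<in>I. L (v i) * lam i x)))"

definition rot :: "real^2 \<Rightarrow> real^2" where
  "rot u = (vector [vector [0, -1], vector [1, 0]] :: real^2^2) *v u"

(* The derivative is taken relative to m, so boundary points are included. The gradient is
   unique for convex m with nonempty interior; where f is not differentiable the value is
   unspecified. *)
definition grad_within :: "(real^2) set \<Rightarrow> (real^2 \<Rightarrow> real) \<Rightarrow> real^2 \<Rightarrow> real^2" where
  "grad_within m f x = (THE g. (f has_derivative (\<lambda>h. g \<bullet> h)) (at x within m))"

definition diff_points ::
    "(real^2) set \<Rightarrow> 'i set \<Rightarrow> ('i \<Rightarrow> real^2 \<Rightarrow> real) \<Rightarrow> (real^2) set" where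
  "diff_points m I lam = {x\<in>m. \<forall>i\<in>I. lam i differentiable (at x within m)}"

definition rot_field ::
    "(real^2) set \<Rightarrow> ('i \<Rightarrow> real^2 \<Rightarrow> real) \<Rightarrow> 'i \<Rightarrow> 'i \<Rightarrow> real^2 \<Rightarrow> real^2" where
  "rot_field m lam i j x = rot (lam i x *\<^sub>R grad_within m (lam j) x)"

(* Functions on a set D are represented by total functions whose values outside D are
   irrelevant: membership means agreement on D with a finite real linear combination. *)
definition span_on :: "(real^2) set \<Rightarrow> (real^2 \<Rightarrow> real^2) set \<Rightarrow> (real^2 \<Rightarrow> real^2) set" where
  "span_on D F = {u. \<exists>T c. finite T \<and> T \<subseteq> F \<and> (\<forall>x\<in>D. u x = (\<Sum>f\<in>T. c f *\<^sub>R f x))}"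

(* 1-forms with coefficients of degree at most 1, via the vector proxies
   u1 dx1 + u2 dx2 <-> (u1, u2). *)
definition P1_Lambda1 :: "(real^2) set \<Rightarrow> (real^2 \<Rightarrow> real^2) set" where
  "P1_Lambda1 m = {u. \<forall>k. \<exists>p. poly_deg_le_1 p \<and> (\<forall>x\<in>m. u x $ k = p x)}"

end

theory Submission
  imports Defs
begin

text \<open>
  Differentiating the reproduction of affine functions \<open>L = (\<Sum>j. L (v j) * lam j)\<close> yields
  \<open>(\<Sum>j. (a \<bullet> v j + c) *\<^sub>R \<nabla>(lam j)) = a\<close>. Multiplying by \<open>lam i\<close>, applying \<open>rot\<close> and letting \<open>a\<close>
  and \<open>c\<close> depend on \<open>v i\<close>, both identities reduce to reproduction of affine functions in the sum
  over \<open>i\<close>: take \<open>a = - rot z\<close> and \<open>c = v i \<bullet> rot z\<close> for the first one, applied to a vector \<open>z\<close>,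
  and \<open>a = - rot (A *v v i)\<close> and \<open>c = 0\<close> for the second one.
\<close>

text \<open>
  The library's uniqueness criteria ask for points of the set near \<open>x\<close> on every coordinate axis
  through \<open>x\<close>, which fails at a vertex of a polygon. Here the two derivatives are compared along
  the segments from \<open>x\<close> into the set, whose directions span the space.
\<close>

lemma has_derivative_unique_within_convex:
  fixes f :: "'a::real_normed_vector \<Rightarrow> 'b::real_normed_vector"
  assumes "convex S" "interior S \<noteq> {}" "x \<in> S"
    and f': "(f has_derivative f') (at x within S)"
    and f'': "(f has_derivative f'') (at x within S)"
  shows "f' = f''"
proof -
  interpret f': bounded_linear f' using f' by (rule has_derivative_bounded_linear)
  interpret f'': bounded_linear f'' using f'' by (rule has_derivative_bounded_linear)
  have eq: "f' (y - x) = f'' (y - x)" if "y \<in> S" for y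
  proof -
    define p where "p = (\<lambda>t::real. x + t *\<^sub>R (y - x))"
    have p0: "p 0 = x" by (simp add: p_def)
    have img: "p ` {0..1} \<subseteq> S"
    proof
      fix w assume "w \<in> p ` {0..1}"
      then obtain t where "0 \<le> t" "t \<le> 1" "w = (1 - t) *\<^sub>R x + t *\<^sub>R y"
        by (auto simp: p_def algebra_simps)
      then show "w \<in> S"
        using \<open>convex S\<close> \<open>x \<in> S\<close> \<open>y \<in> S\<close> by (simp add: convexD_alt)
    qed
    have p: "(p has_vector_derivative (y - x)) (at 0 within {0..1})"
      unfolding p_def by (auto intro!: derivative_eq_intros)
    \<comment> \<open>By the chain rule, a derivative \<open>D\<close> of \<open>f\<close> relative
      to \<open>S\<close> gives \<open>D (y - x)\<close> as the one-sided derivative of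
      \<open>f\<close> along \<open>p\<close> at the end point 0, and that value is unique even when
      \<open>x\<close> lies on the boundary.\<close>
    have "(f \<circ> p has_vector_derivative D (y - x)) (at 0 within {0..1})"
      if "(f has_derivative D) (at x within S)" for D
      using vector_derivative_diff_chain_within[OF p, of f D] has_derivative_subset[OF that img]
      by (simp add: p0)
    from this[OF f'] this[OF f''] show ?thesis
      by (rule vector_derivative_unique_within_closed_interval[of 0 1 0, simplified])
  qed
  obtain z e where "0 < e" and ball: "ball z e \<subseteq> S"
    using \<open>interior S \<noteq> {}\<close> by (metis ex_in_conv mem_interior)
  show ?thesis
  proof
    fix h :: 'a
    \<comment> \<open>Scaling by \<open>s\<close> keeps \<open>z + s *\<^sub>R h\<close> in the
      ball, so \<open>s *\<^sub>R h\<close> is a difference of two displacements from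
      \<open>x\<close> covered by \<open>eq\<close>. The \<open>+ 1\<close> keeps the denominator
      positive when \<open>h = 0\<close>.\<close>
    define s where "s = e / (2 * (norm h + 1))"
    have "s > 0" using \<open>0 < e\<close> by (simp add: s_def add_nonneg_pos)
    have "s * norm h < e"
    proof -
      have "s * norm h \<le> s * (norm h + 1)" using \<open>s > 0\<close> by simp
      also have "\<dots> = e / 2" by (simp add: s_def field_simps add_nonneg_eq_0_iff)
      finally show ?thesis using \<open>0 < e\<close> by simp
    qed
    then have "z + s *\<^sub>R h \<in> S" "z \<in> S"
      using ball \<open>0 < e\<close> \<open>s > 0\<close> by (auto simp: dist_norm subset_iff)
    from eq[OF this(1)] eq[OF this(2)] have "f' (s *\<^sub>R h) = f'' (s *\<^sub>R h)"
      using f'.diff[of "z + s *\<^sub>R h - x" "z - x"] f''.diff[of "z + s *\<^sub>R h - x" "z - x"]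
      by simp
    then have "s *\<^sub>R f' h = s *\<^sub>R f'' h" by (simp add: f'.scaleR f''.scaleR)
    then show "f' h = f'' h" using \<open>s > 0\<close> by simp
  qed
qed

text \<open>This justifies the definite description in \<open>grad_within\<close>: the gradient
  exists as the Riesz vector \<open>adjoint f' 1\<close> of the functional \<open>f'\<close>, and it
  is unique because the derivative relative to \<open>S\<close> is.\<close>

lemma has_derivative_grad_within:
  assumes "convex S" "interior S \<noteq> {}" "x \<in> S"
    and "f differentiable (at x within S)"
  shows "(f has_derivative (\<lambda>h. grad_within S f x \<bullet> h)) (at x within S)"
proof -
  obtain f' where f': "(f has_derivative f') (at x within S)"
    using assms(4) by (auto simp: differentiable_def)
  have "linear f'" using f' by (rule has_derivative_linear)
  then have "f' h = adjoint f' 1 \<bullet> h" for h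
    using adjoint_works[of f' h 1] by (simp add: inner_commute)
  then have "f' = (\<lambda>h. adjoint f' 1 \<bullet> h)" by blast
  with f' have ex: "(f has_derivative (\<lambda>h. adjoint f' 1 \<bullet> h)) (at x within S)" by simp
  show ?thesis unfolding grad_within_def
  proof (rule theI[where a = "adjoint f' 1"])
    fix g assume "(f has_derivative (\<lambda>h. g \<bullet> h)) (at x within S)"
    from has_derivative_unique_within_convex[OF assms(1-3) this ex]
    show "g = adjoint f' 1" by (metis vector_eq_rdot)
  qed (rule ex)
qed

lemma linear_rot: "linear rot"
  unfolding rot_def by (rule matrix_vector_mul_linear)

lemma rot_nth [simp]: "rot u $ 1 = - u $ 2" "rot u $ 2 = u $ 1"
  by (simp_all add: rot_def matrix_vector_mult_def sum_2)

lemma rot_rot [simp]: "rot (rot u) = - u"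
  by (simp add: vec_eq_iff forall_2)

lemma rot_minus [simp]: "rot (- u) = - rot u"
  by (simp add: vec_eq_iff forall_2)

lemma poly_deg_le_1_affine: "poly_deg_le_1 (\<lambda>y. a \<bullet> y + c)"
  unfolding poly_deg_le_1_def
  by (intro exI[of _ c] exI[of _ "a $ 1"] exI[of _ "a $ 2"]) (simp add: inner_vec_def sum_2)

lemma gen_bary_coords_affine:
  assumes "gen_bary_coords m I v lam" "x \<in> m"
  shows "(\<Sum>i\<in>I. (a \<bullet> v i + c) * lam i x) = a \<bullet> x + c"
proof -
  have "\<forall>x\<in>m. a \<bullet> x + c = (\<Sum>i\<in>I. (a \<bullet> v i + c) * lam i x)"
    using assms(1) poly_deg_le_1_affine[of a c] unfolding gen_bary_coords_def by fast
  then show ?thesis using assms(2) by simp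
qed

lemma gen_bary_coords_sum:
  assumes "gen_bary_coords m I v lam" "x \<in> m"
  shows "(\<Sum>i\<in>I. lam i x) = 1"
  using gen_bary_coords_affine[OF assms, of 0 1] by simp

lemma gen_bary_coords_position:
  assumes "gen_bary_coords m I v lam" "x \<in> m"
  shows "(\<Sum>i\<in>I. lam i x *\<^sub>R v i) = x"
proof -
  have "a \<bullet> (\<Sum>i\<in>I. lam i x *\<^sub>R v i) = a \<bullet> x" for a
    using gen_bary_coords_affine[OF assms, of a 0] by (simp add: inner_sum_right mult.commute)
  then show ?thesis by (blast intro: vector_eq_ldot[THEN iffD1])
qed

lemma gen_bary_coords_grad:
  assumes "convex m" "interior m \<noteq> {}"
    and coords: "gen_bary_coords m I v lam" and x: "x \<in> diff_points m I lam"
  shows "(\<Sum>j\<in>I. (a \<bullet> v j + c) *\<^sub>R grad_within m (lam j) x) = a"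
proof -
  have xm: "x \<in> m" using x by (simp add: diff_points_def)
  have grad: "(lam j has_derivative (\<lambda>h. grad_within m (lam j) x \<bullet> h)) (at x within m)"
    if "j \<in> I" for j
    using x that assms(1,2) by (intro has_derivative_grad_within) (auto simp: diff_points_def)
  have "((\<lambda>y. \<Sum>j\<in>I. (a \<bullet> v j + c) * lam j y) has_derivative
      (\<lambda>h. \<Sum>j\<in>I. (a \<bullet> v j + c) * (grad_within m (lam j) x \<bullet> h))) (at x within m)"
    by (intro has_derivative_sum has_derivative_mult_right grad)
  \<comment> \<open>The weighted sum equals the affine function on \<open>m\<close> only; this
    suffices since the derivative is taken within \<open>m\<close>.\<close>
  then have 1: "((\<lambda>y. a \<bullet> y + c) has_derivative
      (\<lambda>h. \<Sum>j\<in>I. (a \<bullet> v j + c) * (grad_within m (lam j) x \<bullet> h))) (at x within m)"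
    by (rule has_derivative_transform[OF xm, rotated])
      (simp add: gen_bary_coords_affine[OF coords])
  have 2: "((\<lambda>y. a \<bullet> y + c) has_derivative (\<lambda>h. a \<bullet> h)) (at x within m)"
    by (auto intro!: derivative_eq_intros)
  have "(\<Sum>j\<in>I. (a \<bullet> v j + c) *\<^sub>R grad_within m (lam j) x) \<bullet> h = a \<bullet> h" for h
    using fun_cong[OF has_derivative_unique_within_convex[OF assms(1,2) xm 1 2], of h]
    by (simp add: inner_sum_left)
  then show ?thesis by (blast intro: vector_eq_rdot[THEN iffD1])
qed

text \<open>The inner sum over \<open>j\<close> of both identities: \<open>s\<close> stands for
  \<open>lam i x\<close>, which is constant in \<open>j\<close>.\<close>

lemma gen_bary_coords_rot_grad:
  assumes "convex m" "interior m \<noteq> {}"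
    and "gen_bary_coords m I v lam" "x \<in> diff_points m I lam"
  shows "(\<Sum>j\<in>I. (a \<bullet> v j + c) *\<^sub>R rot (s *\<^sub>R grad_within m (lam j) x)) = s *\<^sub>R rot a"
proof -
  have "(\<Sum>j\<in>I. (a \<bullet> v j + c) *\<^sub>R rot (s *\<^sub>R grad_within m (lam j) x)) =
      s *\<^sub>R rot (\<Sum>j\<in>I. (a \<bullet> v j + c) *\<^sub>R grad_within m (lam j) x)"
    by (simp add: linear_sum[OF linear_rot] linear_scale[OF linear_rot] scaleR_sum_right
        mult.commute)
  then show ?thesis by (simp add: gen_bary_coords_grad[OF assms])
qed

text \<open>The first identity applied to a vector \<open>z\<close>, since an outer product of p and
  q sends \<open>z\<close> to the multiple of p by the inner product of q and \<open>z\<close>. In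
  this form it also produces the constant fields for the span.\<close>

lemma gen_bary_coords_rot_const:
  assumes "convex m" "interior m \<noteq> {}"
    and coords: "gen_bary_coords m I v lam" and x: "x \<in> diff_points m I lam"
  shows "(\<Sum>i\<in>I. \<Sum>j\<in>I. (rot (v j - v i) \<bullet> z) *\<^sub>R rot (lam i x *\<^sub>R grad_within m (lam j) x)) = z"
proof -
  \<comment> \<open>\<open>rot\<close> is skew-adjoint, so the coefficient is affine in
    \<open>v j\<close> with linear part \<open>- rot z\<close>, which \<open>rot\<close> maps back
    to \<open>z\<close>.\<close>
  have "rot (v j - v i) \<bullet> z = - rot z \<bullet> v j + v i \<bullet> rot z" for i j
    by (simp add: inner_vec_def sum_2 algebra_simps)
  then have "(\<Sum>j\<in>I. (rot (v j - v i) \<bullet> z) *\<^sub>R rot (lam i x *\<^sub>R grad_within m (lam j) x)) =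
      lam i x *\<^sub>R z" for i
    using gen_bary_coords_rot_grad[OF assms, of "- rot z" "v i \<bullet> rot z" "lam i x"]
    by simp
  then show ?thesis
    using gen_bary_coords_sum[OF coords] x
    by (simp add: diff_points_def flip: scaleR_sum_left)
qed

lemma gen_bary_coords_rot_linear:
  assumes "convex m" "interior m \<noteq> {}"
    and coords: "gen_bary_coords m I v lam" and x: "x \<in> diff_points m I lam"
  shows "(\<Sum>i\<in>I. \<Sum>j\<in>I. ((- rot (A *v v i)) \<bullet> v j) *\<^sub>R
      rot (lam i x *\<^sub>R grad_within m (lam j) x)) = A *v x"
proof -
  have "(\<Sum>j\<in>I. ((- rot (A *v v i)) \<bullet> v j) *\<^sub>R rot (lam i x *\<^sub>R grad_within m (lam j) x)) =
      A *v (lam i x *\<^sub>R v i)" for i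
    using gen_bary_coords_rot_grad[OF assms, of "- rot (A *v v i)" 0 "lam i x"]
    by (simp add: matrix_vector_mult_scaleR)
  moreover have "(\<Sum>i\<in>I. A *v (lam i x *\<^sub>R v i)) = A *v (\<Sum>i\<in>I. lam i x *\<^sub>R v i)"
    by (rule linear_sum[OF matrix_vector_mul_linear, symmetric])
  ultimately show ?thesis
    using gen_bary_coords_position[OF coords] x by (simp add: diff_points_def)
qed

lemma P1_Lambda1_affine:
  assumes "u \<in> P1_Lambda1 m"
  obtains A :: "real^2^2" and b where "\<And>x. x \<in> m \<Longrightarrow> u x = b + A *v x"
proof -
  from assms obtain p where p: "\<And>k. poly_deg_le_1 (p k)" "\<And>k x. x \<in> m \<Longrightarrow> u x $ k = p k x"
    unfolding P1_Lambda1_def by simp metis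
  then obtain \<alpha> \<beta> \<gamma> where "\<And>k x. p k x = \<alpha> k + \<beta> k * x $ 1 + \<gamma> k * x $ 2"
    unfolding poly_deg_le_1_def by metis
  then have "u x = (\<chi> k. \<alpha> k) + (\<chi> k l. if l = 1 then \<beta> k else \<gamma> k) *v x" if "x \<in> m" for x
    using p(2)[OF that] by (simp add: vec_eq_iff matrix_vector_mult_def sum_2)
  then show thesis by (rule that)
qed

text \<open>
  \<^const>\<open>span_on\<close> ranges over sets of fields, so the coefficients of indices with equal fields have
  to be added up.
\<close>

lemma span_on_indexed:
  assumes "finite K" and F: "\<And>k. k \<in> K \<Longrightarrow> F k \<in> \<F>"
    and u: "\<And>x. x \<in> D \<Longrightarrow> u x = (\<Sum>k\<in>K. c k *\<^sub>R F k x)"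
  shows "u \<in> span_on D \<F>"
proof -
  have "u x = (\<Sum>f\<in>F ` K. (\<Sum>k | k \<in> K \<and> F k = f. c k) *\<^sub>R f x)" if "x \<in> D" for x
    unfolding u[OF that] sum.image_gen[OF \<open>finite K\<close>, of _ F]
    by (auto intro!: sum.cong simp: scaleR_sum_left)
  then show ?thesis
    unfolding span_on_def using assms(1) F
    by (intro CollectI exI[of _ "F ` K"] exI[of _ "\<lambda>f. \<Sum>k | k \<in> K \<and> F k = f. c k"]) auto
qed

theorem corollary4p2:
  fixes m :: "(real^2) set" and I :: "'i set"
    and v :: "'i \<Rightarrow> real^2" and lam :: "'i \<Rightarrow> real^2 \<Rightarrow> real"
  assumes polygon: "convex_polygon m"
    and vertices: "bij_betw v I (vertices_of m)"
    and coords: "gen_bary_coords m I v lam"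
  shows "(\<forall>x\<in>diff_points m I lam.
            (\<Sum>i\<in>I. \<Sum>j\<in>I. columnvector (rot (lam i x *\<^sub>R grad_within m (lam j) x))
               ** transpose (columnvector (rot (v j - v i)) :: real^1^2)) = mat 1)
       \<and> (\<forall>A :: real^2^2. \<forall>x\<in>diff_points m I lam.
            (\<Sum>i\<in>I. \<Sum>j\<in>I. ((- rot (A *v v i)) \<bullet> v j) *\<^sub>R
               rot (lam i x *\<^sub>R grad_within m (lam j) x)) = A *v x)
       \<and> P1_Lambda1 m \<subseteq>
           span_on (diff_points m I lam) {rot_field m lam i j | i j. i \<in> I \<and> j \<in> I}"
proof (intro conjI allI ballI subsetI)
  have "convex m" "interior m \<noteq> {}" "finite (vertices_of m)"
    using polygon finite_polyhedron_extreme_points[of m]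
    by (auto simp: convex_polygon_def vertices_of_def polytope_imp_convex polytope_imp_polyhedron)
  then have "finite I" using vertices bij_betw_finite by blast
  note const = gen_bary_coords_rot_const[OF \<open>convex m\<close> \<open>interior m \<noteq> {}\<close> coords]
  note linear = gen_bary_coords_rot_linear[OF \<open>convex m\<close> \<open>interior m \<noteq> {}\<close> coords]
  show "(\<Sum>i\<in>I. \<Sum>j\<in>I. columnvector (rot (lam i x *\<^sub>R grad_within m (lam j) x))
      ** transpose (columnvector (rot (v j - v i)) :: real^1^2)) = mat 1"
    if "x \<in> diff_points m I lam" for x
  proof -
    \<comment> \<open>Choosing \<open>z\<close> as the unit vector \<open>axis l 1\<close> picks out
      column \<open>l\<close> of the matrix sum.\<close>
    have "(\<Sum>i\<in>I. \<Sum>j\<in>I. rot (lam i x *\<^sub>R grad_within m (lam j) x) $ k * rot (v j - v i) $ l) =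
        mat 1 $ k $ l" for k l :: 2
      using arg_cong[OF const[OF that, of "axis l 1"], of "\<lambda>w. w $ k"]
      by (simp add: inner_axis mult.commute) (simp add: mat_def axis_def)
    then show ?thesis
      by (simp add: vec_eq_iff matrix_matrix_mult_def columnvector_def transpose_def)
  qed
  show "(\<Sum>i\<in>I. \<Sum>j\<in>I. ((- rot (A *v v i)) \<bullet> v j) *\<^sub>R
      rot (lam i x *\<^sub>R grad_within m (lam j) x)) = A *v x"
    if "x \<in> diff_points m I lam" for A x
    using that by (rule linear)
  fix u assume "u \<in> P1_Lambda1 m"
  then obtain A b where u: "\<And>x. x \<in> m \<Longrightarrow> u x = b + A *v x"
    by (rule P1_Lambda1_affine) blast
  show "u \<in> span_on (diff_points m I lam) {rot_field m lam i j | i j. i \<in> I \<and> j \<in> I}"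
  proof (rule span_on_indexed)
    show "finite (I \<times> I)" using \<open>finite I\<close> by simp
    show "(case k of (i, j) \<Rightarrow> rot_field m lam i j) \<in>
        {rot_field m lam i j | i j. i \<in> I \<and> j \<in> I}" if "k \<in> I \<times> I" for k
      using that by auto
    \<comment> \<open>The first summand of the coefficient reproduces the constant part
      \<open>b\<close>, the second the linear part \<open>A *v x\<close>. Neither depends on
      \<open>x\<close>, as membership in the span demands.\<close>
    show "u x = (\<Sum>k\<in>I \<times> I. (case k of (i, j) \<Rightarrow>
        rot (v j - v i) \<bullet> b + (- rot (A *v v i)) \<bullet> v j) *\<^sub>R
        (case k of (i, j) \<Rightarrow> rot_field m lam i j) x)"
      if x: "x \<in> diff_points m I lam" for x
    proof -
      have "u x = b + A *v x" using u x by (simp add: diff_points_def)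
      also have "\<dots> = (\<Sum>i\<in>I. \<Sum>j\<in>I. (rot (v j - v i) \<bullet> b + (- rot (A *v v i)) \<bullet> v j) *\<^sub>R
          rot_field m lam i j x)"
        unfolding rot_field_def scaleR_add_left sum.distrib const[OF x] linear[OF x] ..
      finally show ?thesis by (simp add: sum.cartesian_product case_prod_beta)
    qed
  qed
qed

end
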